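(* Let $(A,\circ)$ be a finite-dimensional simple Novikov algebra over an algebraically closed field $\mathbf{k}$ of characteristic $p>2$, with $\dim(A)\geq 2$. Then there are no non-trivial transposed Novikov-Poisson algebra structures on $(A,\circ)$.
   Context: All binary operations are $\mathbf{k}$-bilinear and algebras need not be unital. A (left) Novikov algebra $(A,\circ)$ is a vector space with a binary operation satisfying $(x\circ y)\circ z=(x\circ z)\circ y$ and $(x\circ y)\circ z-x\circ(y\circ z)=(y\circ x)\circ z-y\circ(x\circ z)$ for all $x,y,z$; it is simple if $A\circ A\neq\{0\}$ and its only (two-sided) ideals are $\{0\}$ and $A$. A transposed Novikov-Poisson algebra is a triple $(A,\cdot,\circ)$ where $(A,\cdot)$ is a commutative associative algebra, $(A,\circ)$ is a Novikov algebra, and for all $x,y,z\in A$: $(x\cdot y)\circ z=(x\cdot z)\circ y$ and $2z\cdot(x\circ y)=(z\cdot x)\circ y+x\circ(z\cdot y)$. It is trivial if $\cdot$ is zero or $\circ$ is zero. A non-trivial transposed Novikov-Poisson algebra structure on $(A,\circ)$ is an operation $\cdot$ on $A$ such that $(A,\cdot,\circ)$ is a transposed Novikov-Poisson algebra that is not trivial. *)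

theory Defs
  imports "HOL-Computational_Algebra.Computational_Algebra"
begin

text \<open>
  A vector space is given by its scalar multiplication on a whole type, as in
  \<^theory>\<open>HOL.Vector_Spaces\<close>. Algebras need be neither associative nor unital.
\<close>

locale bilinear_algebra = vector_space scale
  for scale :: "'k::field \<Rightarrow> 'a::ab_group_add \<Rightarrow> 'a" +
  fixes mul :: "'a \<Rightarrow> 'a \<Rightarrow> 'a"
  assumes linear_left: "Vector_Spaces.linear scale scale (\<lambda>x. mul x y)"
    and linear_right: "Vector_Spaces.linear scale scale (\<lambda>y. mul x y)"
begin

definition two_sided_ideal :: "'a set \<Rightarrow> bool" where
  "two_sided_ideal I \<longleftrightarrow> subspace I \<and> (\<forall>a. \<forall>x\<in>I. mul a x \<in> I \<and> mul x a \<in> I)"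

definition simple :: bool where
  "simple \<longleftrightarrow> (\<exists>x y. mul x y \<noteq> 0) \<and> (\<forall>I. two_sided_ideal I \<longrightarrow> I = {0} \<or> I = UNIV)"

end

locale comm_assoc_algebra = bilinear_algebra scale dot
  for scale :: "'k::field \<Rightarrow> 'a::ab_group_add \<Rightarrow> 'a" and dot :: "'a \<Rightarrow> 'a \<Rightarrow> 'a" (infixl "\<cdot>" 70) +
  assumes dot_assoc: "(x \<cdot> y) \<cdot> z = x \<cdot> (y \<cdot> z)"
    and dot_commute: "x \<cdot> y = y \<cdot> x"

locale novikov_algebra = bilinear_algebra scale circ
  for scale :: "'k::field \<Rightarrow> 'a::ab_group_add \<Rightarrow> 'a" and circ :: "'a \<Rightarrow> 'a \<Rightarrow> 'a" (infixl "\<odot>" 70) +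
  assumes right_commute: "(x \<odot> y) \<odot> z = (x \<odot> z) \<odot> y"
    and left_symmetric: "(x \<odot> y) \<odot> z - x \<odot> (y \<odot> z) = (y \<odot> x) \<odot> z - y \<odot> (x \<odot> z)"

locale simple_novikov_algebra = novikov_algebra +
  assumes simple: simple

locale transposed_novikov_poisson_algebra =
  dot: comm_assoc_algebra scale dot + circ: novikov_algebra scale circ
  for scale :: "'k::field \<Rightarrow> 'a::ab_group_add \<Rightarrow> 'a"
    and dot :: "'a \<Rightarrow> 'a \<Rightarrow> 'a" (infixl "\<cdot>" 70)
    and circ :: "'a \<Rightarrow> 'a \<Rightarrow> 'a" (infixl "\<odot>" 70) +
  assumes dot_circ_commute: "(x \<cdot> y) \<odot> z = (x \<cdot> z) \<odot> y"
    and transposed_compat: "scale 2 (z \<cdot> (x \<odot> y)) = (z \<cdot> x) \<odot> y + x \<odot> (z \<cdot> y)"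
begin

definition trivial :: bool where
  "trivial \<longleftrightarrow> (\<forall>x y. x \<cdot> y = 0) \<or> (\<forall>x y. x \<odot> y = 0)"

end

definition nontrivial_tnp_structure ::
  "('k::field \<Rightarrow> 'a::ab_group_add \<Rightarrow> 'a) \<Rightarrow> ('a \<Rightarrow> 'a \<Rightarrow> 'a) \<Rightarrow> ('a \<Rightarrow> 'a \<Rightarrow> 'a) \<Rightarrow> bool" where
  "nontrivial_tnp_structure scale circ dot \<longleftrightarrow>
     transposed_novikov_poisson_algebra scale dot circ \<and>
     \<not> transposed_novikov_poisson_algebra.trivial dot circ"

end

theory Submission
  imports Defs
begin

text \<open>
  Write \<open>R\<^sub>z\<close> for the operator \<open>x \<mapsto> x \<odot> z\<close> and \<open>M\<^sub>z\<close> for \<open>x \<mapsto> z \<cdot> x\<close>.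

  In a Novikov algebra the \<open>R\<^sub>z\<close> commute, so over an algebraically closed field they have a
  common eigenvector. Left symmetry says that the commutator of \<open>R\<^sub>z\<close> with a left multiplication
  lies in the commutative algebra generated by all right multiplications. Therefore the
  generalized eigenspaces of every \<open>R\<^sub>z\<close> are ideals, and in a simple algebra each \<open>R\<^sub>z\<close> has only
  one eigenvalue. The common kernel of the \<open>R\<^sub>z\<close> is an ideal too, hence zero, so some \<open>R\<^sub>z\<close>
  does not kill the common eigenvector; rescaling \<open>z\<close> gives an \<open>e\<close> with \<open>R\<^sub>e\<close> unipotent.

  For \<open>T = M\<^sub>e\<close> and \<open>U = R\<^sub>e\<close>, a transposed structure \<open>\<cdot>\<close> yields the two relations
  \<open>2 T U = U T + R\<^sub>w\<close>, where \<open>w = e \<cdot> e\<close>, and \<open>U M\<^sub>z = R\<^sub>z T\<close>. Taking the commutator of the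
  first one with \<open>U\<close> gives \<open>U D = 2 D U\<close> for \<open>D = U T - T U\<close>; as \<open>U\<close> has \<open>1\<close> as its only
  eigenvalue, this forces \<open>D = 0\<close>. Then \<open>T U = R\<^sub>w\<close>, so \<open>T\<close> commutes with every \<open>R\<^sub>z\<close>, and
  \<open>U (x \<cdot> z) = T (x \<odot> z)\<close>.

  Because \<open>\<cdot>\<close> is commutative, the kernel of \<open>T\<close> contains all commutators \<open>x \<odot> z - z \<odot> x\<close>. It
  is a right ideal as \<open>T\<close> commutes with the \<open>R\<^sub>z\<close>, hence an ideal. If it is everything, then
  \<open>U (x \<cdot> z) = 0\<close> and \<open>\<cdot>\<close> vanishes. If it is zero, then \<open>\<odot>\<close> is commutative; now the
  eigenspaces of the \<open>R\<^sub>z\<close> are ideals, so all \<open>R\<^sub>z\<close> are scalars and the dimension is at most one.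
\<close>

section \<open>Common eigenvectors\<close>

locale closed_field_fd_space = finite_dimensional_vector_space scale Basis
  for scale :: "'k::alg_closed_field \<Rightarrow> 'a::ab_group_add \<Rightarrow> 'a" and Basis :: "'a set"
begin

definition poly_act :: "('a \<Rightarrow> 'a) \<Rightarrow> 'k poly \<Rightarrow> 'a \<Rightarrow> 'a" where
  "poly_act f p w = (\<Sum>i\<le>degree p. scale (coeff p i) ((f ^^ i) w))"

lemma poly_act_eq_sum:
  assumes "degree p \<le> N"
  shows "poly_act f p w = (\<Sum>i\<le>N. scale (coeff p i) ((f ^^ i) w))"
  unfolding poly_act_def
  by (rule sum.mono_neutral_left) (use assms in \<open>auto simp: coeff_eq_0\<close>)

lemma poly_act_linear_factor:
  assumes f: "Vector_Spaces.linear scale scale f"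
  shows "poly_act f ([:-c, 1:] * q) w = f (poly_act f q w) - scale c (poly_act f q w)"
proof -
  interpret f: Vector_Spaces.linear scale scale f by (rule f)
  let ?N = "Suc (degree q)"
  have deg: "degree ([:-c, 1:] * q) \<le> ?N"
    using degree_mult_le[of "[:-c, 1:]" q] by simp
  have "poly_act f ([:-c, 1:] * q) w
      = (\<Sum>i\<le>?N. scale (coeff (pCons 0 q) i) ((f ^^ i) w))
        - (\<Sum>i\<le>?N. scale c (scale (coeff q i) ((f ^^ i) w)))"
    by (simp only: poly_act_eq_sum[OF deg] sum_subtractf[symmetric], intro sum.cong)
       (simp_all add: algebra_simps)
  also have "(\<Sum>i\<le>?N. scale (coeff (pCons 0 q) i) ((f ^^ i) w)) = f (poly_act f q w)"
    by (subst sum.atMost_Suc_shift) (simp add: poly_act_def f.sum f.scale)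
  also have "(\<Sum>i\<le>?N. scale c (scale (coeff q i) ((f ^^ i) w))) = scale c (poly_act f q w)"
    by (simp only: poly_act_eq_sum[of q ?N, OF le_SucI[OF order_refl]] scale_sum_right)
  finally show ?thesis .
qed

lemma orbit_annihilated_by_poly: "\<exists>p. p \<noteq> 0 \<and> poly_act f p w = 0"
proof (cases "inj_on (\<lambda>i. (f ^^ i) w) {..dimension}")
  case True
  let ?S = "(\<lambda>i. (f ^^ i) w) ` {..dimension}"
  have "card ?S = Suc dimension"
    using card_image[OF True] by simp
  then have "dependent ?S"
    using independent_bound_general[of ?S] dim_subset_UNIV[of ?S] by fastforce
  then obtain u where u: "\<exists>v\<in>?S. u v \<noteq> 0" "(\<Sum>v\<in>?S. scale (u v) v) = 0"
    using dependent_finite[of ?S] by auto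
  let ?p = "\<Sum>i\<le>dimension. monom (u ((f ^^ i) w)) i"
  have coeff: "coeff ?p j = (if j \<le> dimension then u ((f ^^ j) w) else 0)" for j
    by (simp add: coeff_sum)
  have "?p \<noteq> 0"
    using u(1) coeff by (metis (no_types, lifting) atMost_iff coeff_0 imageE)
  moreover have deg: "degree ?p \<le> dimension"
    by (rule degree_le) (simp add: coeff)
  moreover have "poly_act f ?p w = 0"
    using u(2) by (simp add: poly_act_eq_sum[OF deg] coeff sum.reindex[OF True])
  ultimately show ?thesis by blast
next
  case False
  then obtain i j where ij: "i \<noteq> j" "(f ^^ i) w = (f ^^ j) w"
    by (auto simp: inj_on_def)
  let ?p = "monom 1 i - monom 1 j :: 'k poly"
  have "coeff ?p i \<noteq> 0"
    using ij by simp
  then have "?p \<noteq> 0" by (metis coeff_0)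
  moreover have deg: "degree ?p \<le> max i j"
    by (rule degree_diff_le) (auto intro: order_trans[OF degree_monom_le])
  moreover have "poly_act f ?p w = 0"
    using ij(2)
    by (simp add: poly_act_eq_sum[OF deg] scale_left_diff_distrib sum_subtractf if_distrib[of "\<lambda>c. scale c _"] cong: if_cong)
  ultimately show ?thesis by blast
qed

text \<open>
  Some nonzero polynomial in \<open>f\<close> kills \<open>w\<close>. Splitting off its linear factors one at a time, the
  last nonzero vector met before reaching zero is an eigenvector.
\<close>

lemma exists_eigenvector_in_invariant_subspace:
  assumes f: "Vector_Spaces.linear scale scale f"
    and W: "subspace W" "f ` W \<subseteq> W" and w: "w \<in> W" "w \<noteq> 0"
  shows "\<exists>v\<in>W. v \<noteq> 0 \<and> (\<exists>c. f v = scale c v)"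
proof -
  have orbit: "(f ^^ i) w \<in> W" for i
    by (induction i) (use W w in auto)
  have act: "poly_act f p w \<in> W" for p
    unfolding poly_act_def by (intro subspace_sum W subspace_scale orbit)
  have "p \<noteq> 0 \<Longrightarrow> poly_act f p w = 0 \<Longrightarrow> ?thesis" for p
  proof (induction "degree p" arbitrary: p rule: less_induct)
    case less
    have "degree p \<noteq> 0"
    proof
      assume "degree p = 0"
      then have "coeff p 0 \<noteq> 0" "scale (coeff p 0) w = 0"
        using less.prems leading_coeff_neq_0[of p] by (auto simp: poly_act_def)
      then show False using w by simp
    qed
    then obtain c where "poly p c = 0"
      using alg_closed_imp_poly_has_root by blast
    then obtain q where p: "p = [:-c, 1:] * q"
      using poly_eq_0_iff_dvd by (metis dvdE)
    then have q: "q \<noteq> 0" using less.prems by auto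
    show ?case
    proof (cases "poly_act f q w = 0")
      case True
      have "degree q < degree p"
        using q by (simp add: p degree_mult_eq del: mult_pCons_left)
      then show ?thesis using less.hyps q True by blast
    next
      case False
      have "f (poly_act f q w) = scale c (poly_act f q w)"
        using less.prems(2) unfolding p poly_act_linear_factor[OF f] by simp
      then show ?thesis using False act by blast
    qed
  qed
  then show ?thesis using orbit_annihilated_by_poly by blast
qed

text \<open>
  A nonzero subspace of least dimension among the invariant ones meets an eigenspace of each
  operator; the intersection is again invariant, so it is the whole subspace, on which every
  operator is therefore scalar.
\<close>

lemma exists_common_eigenvector:
  assumes lin: "\<And>f. f \<in> F \<Longrightarrow> Vector_Spaces.linear scale scale f"
    and comm: "\<And>f g x. f \<in> F \<Longrightarrow> g \<in> F \<Longrightarrow> f (g x) = g (f x)"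
    and nontrivial: "(a :: 'a) \<noteq> 0"
  shows "\<exists>v. v \<noteq> 0 \<and> (\<forall>f\<in>F. \<exists>c. f v = scale c v)"
proof -
  let ?P = "\<lambda>W. subspace W \<and> (\<exists>w\<in>W. w \<noteq> 0) \<and> (\<forall>f\<in>F. f ` W \<subseteq> W)"
  have "?P UNIV" using nontrivial by auto
  then obtain W where W: "?P W" and least: "\<And>U. ?P U \<Longrightarrow> dim W \<le> dim U"
    using ex_has_least_nat[of ?P UNIV dim] by blast
  from W obtain w where w: "w \<in> W" "w \<noteq> 0" by blast
  have "\<exists>c. f w = scale c w" if f: "f \<in> F" for f
  proof -
    interpret f: Vector_Spaces.linear scale scale f by (rule lin[OF f])
    obtain v c where v: "v \<in> W" "v \<noteq> 0" "f v = scale c v"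
      using exists_eigenvector_in_invariant_subspace[OF lin[OF f], of W w] W w f by blast
    let ?U = "{x\<in>W. f x = scale c x}"
    have sub: "subspace ?U"
      using W by (auto simp: subspace_def f.zero f.add f.scale scale_right_distrib mult.commute)
    have inv: "g ` ?U \<subseteq> ?U" if g: "g \<in> F" for g
    proof -
      interpret g: Vector_Spaces.linear scale scale g by (rule lin[OF g])
      show ?thesis using W g comm[OF f g] by (auto simp: g.scale)
    qed
    have "dim W \<le> dim ?U"
      by (rule least) (use sub inv v in blast)
    then have "?U = W"
      using sub W by (intro subspace_dim_equal) auto
    then show ?thesis using w by blast
  qed
  then show ?thesis using w by blast
qed

end

section \<open>Generalized eigenspaces of right multiplications\<close>

context novikov_algebra
begin

lemmas circ_left = module_hom.add[OF module_hom_linearI[OF linear_left]]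
  module_hom.diff[OF module_hom_linearI[OF linear_left]]
  module_hom.scale[OF module_hom_linearI[OF linear_left]]
  module_hom.zero[OF module_hom_linearI[OF linear_left]]

lemmas circ_right = module_hom.add[OF module_hom_linearI[OF linear_right]]
  module_hom.diff[OF module_hom_linearI[OF linear_right]]
  module_hom.scale[OF module_hom_linearI[OF linear_right]]
  module_hom.zero[OF module_hom_linearI[OF linear_right]]

abbreviation shifted_right_mult :: "'a \<Rightarrow> 'k \<Rightarrow> 'a \<Rightarrow> 'a" where
  "shifted_right_mult z c \<equiv> \<lambda>x. x \<odot> z - scale c x"

definition generalized_eigenspace :: "'a \<Rightarrow> 'k \<Rightarrow> 'a set" where
  "generalized_eigenspace z c = {y. \<exists>n. (shifted_right_mult z c ^^ n) y = 0}"

lemma linear_shifted_right_mult_funpow: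
  "Vector_Spaces.linear scale scale (shifted_right_mult z c ^^ n)"
proof (induction n)
  case 0
  show ?case by (simp add: Vector_Spaces.linear_iff vector_space_axioms)
next
  case (Suc n)
  then show ?case
    by (simp add: Vector_Spaces.linear_iff vector_space_axioms circ_left algebra_simps)
qed

lemma shifted_right_mult_funpow_zero: "(shifted_right_mult z c ^^ n) 0 = 0"
  by (induction n) (simp_all add: circ_left)

lemma shifted_right_mult_funpow_commute_right_mult:
  "(shifted_right_mult z c ^^ n) (y \<odot> x) = (shifted_right_mult z c ^^ n) y \<odot> x"
  by (induction n) (simp_all add: circ_left right_commute[of _ x z])

lemma shifted_right_mult_funpow_mono:
  assumes "(shifted_right_mult z c ^^ n) y = 0" "n \<le> m"
  shows "(shifted_right_mult z c ^^ m) y = 0"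
proof -
  have "(shifted_right_mult z c ^^ ((m - n) + n)) y = 0"
    using assms(1) by (simp only: funpow_add o_apply shifted_right_mult_funpow_zero)
  then show ?thesis using assms(2) by simp
qed

text \<open>
  By left symmetry \<open>x \<odot> _\<close> commutes with \<open>R\<^sub>z - c\<close> up to the operator
  \<open>y \<mapsto> (y \<odot> x) \<odot> z - y \<odot> (x \<odot> z)\<close>, a polynomial in right multiplications that itself commutes
  with \<open>R\<^sub>z - c\<close>. So a left multiplication raises the nilpotency order by at most one.
\<close>

lemma shifted_right_mult_funpow_left_mult:
  assumes "(shifted_right_mult z c ^^ n) y = 0"
  shows "(shifted_right_mult z c ^^ Suc n) (x \<odot> y) = 0"
  using assms
proof (induction n arbitrary: y)
  case 0
  then show ?case by (simp add: circ_left circ_right)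
next
  case (Suc n)
  let ?Q = "shifted_right_mult z c"
  interpret Q: Vector_Spaces.linear scale scale "?Q ^^ Suc n"
    by (rule linear_shifted_right_mult_funpow)
  have "?Q (x \<odot> y) = x \<odot> ?Q y + ((y \<odot> x) \<odot> z - y \<odot> (x \<odot> z))"
    using left_symmetric[of x y z] by (simp add: circ_right algebra_simps)
  then have "(?Q ^^ Suc (Suc n)) (x \<odot> y)
      = (?Q ^^ Suc n) (x \<odot> ?Q y) + (((?Q ^^ Suc n) y \<odot> x) \<odot> z - (?Q ^^ Suc n) y \<odot> (x \<odot> z))"
    by (simp only: funpow_Suc_right[of "Suc n"] o_apply Q.add Q.diff
        shifted_right_mult_funpow_commute_right_mult)
  moreover have "(?Q ^^ Suc n) (x \<odot> ?Q y) = 0"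
    by (rule Suc.IH) (use Suc.prems in \<open>simp only: funpow_Suc_right o_apply\<close>)
  ultimately show ?case
    using Suc.prems by (simp only: circ_left) simp
qed

lemma ideal_generalized_eigenspace: "two_sided_ideal (generalized_eigenspace z c)"
proof -
  let ?Q = "shifted_right_mult z c"
  have "subspace (generalized_eigenspace z c)"
  proof (rule subspaceI)
    show "0 \<in> generalized_eigenspace z c"
      using shifted_right_mult_funpow_zero by (auto simp: generalized_eigenspace_def)
  next
    fix x y assume "x \<in> generalized_eigenspace z c" "y \<in> generalized_eigenspace z c"
    then obtain m n where "(?Q ^^ m) x = 0" "(?Q ^^ n) y = 0"
      by (auto simp: generalized_eigenspace_def)
    then have zero: "(?Q ^^ max m n) x = 0" "(?Q ^^ max m n) y = 0"
      by (auto intro: shifted_right_mult_funpow_mono)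
    interpret Q: Vector_Spaces.linear scale scale "?Q ^^ max m n"
      by (rule linear_shifted_right_mult_funpow)
    have "(?Q ^^ max m n) (x + y) = 0"
      by (simp only: Q.add zero) simp
    then show "x + y \<in> generalized_eigenspace z c"
      by (auto simp only: generalized_eigenspace_def)
  next
    fix a x assume "x \<in> generalized_eigenspace z c"
    then obtain n where zero: "(?Q ^^ n) x = 0"
      by (auto simp: generalized_eigenspace_def)
    interpret Q: Vector_Spaces.linear scale scale "?Q ^^ n"
      by (rule linear_shifted_right_mult_funpow)
    have "(?Q ^^ n) (scale a x) = 0"
      by (simp only: Q.scale zero) simp
    then show "scale a x \<in> generalized_eigenspace z c"
      by (auto simp only: generalized_eigenspace_def)
  qed
  moreover have "x \<odot> y \<in> generalized_eigenspace z c" "y \<odot> x \<in> generalized_eigenspace z c"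
    if y: "y \<in> generalized_eigenspace z c" for x y
  proof -
    obtain n where n: "(?Q ^^ n) y = 0"
      using y by (auto simp: generalized_eigenspace_def)
    show "x \<odot> y \<in> generalized_eigenspace z c"
      using shifted_right_mult_funpow_left_mult[OF n]
      by (auto simp only: generalized_eigenspace_def)
    have "(?Q ^^ n) (y \<odot> x) = 0"
      by (simp only: shifted_right_mult_funpow_commute_right_mult n circ_left)
    then show "y \<odot> x \<in> generalized_eigenspace z c"
      by (auto simp only: generalized_eigenspace_def)
  qed
  ultimately show ?thesis by (auto simp: two_sided_ideal_def)
qed

lemma ideal_annihilator: "two_sided_ideal {y. \<forall>z. y \<odot> z = 0}"
proof -
  have "(x \<odot> y) \<odot> z = 0" if "\<forall>z. y \<odot> z = 0" for x y z
    using left_symmetric[of x y z] that by (simp add: circ_left circ_right)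
  then show ?thesis
    by (auto simp: two_sided_ideal_def subspace_def circ_left)
qed

end

context simple_novikov_algebra
begin

lemma ideal_eq_UNIV:
  assumes "two_sided_ideal I" "v \<in> I" "v \<noteq> 0"
  shows "I = UNIV"
  using assms simple by (auto simp: simple_def)

lemma nonzero_has_nonzero_right_multiple:
  assumes "v \<noteq> 0"
  shows "\<exists>z. v \<odot> z \<noteq> 0"
  using ideal_eq_UNIV[OF ideal_annihilator, of v] assms simple
  by (auto simp: simple_def)

lemma right_mult_locally_nilpotent:
  assumes "v \<odot> z = scale c v" "v \<noteq> 0"
  shows "\<exists>n. (shifted_right_mult z c ^^ n) y = 0"
proof -
  have "(shifted_right_mult z c ^^ 1) v = 0"
    using assms by simp
  then have "v \<in> generalized_eigenspace z c"
    by (auto simp only: generalized_eigenspace_def)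
  then have "generalized_eigenspace z c = UNIV"
    using ideal_eq_UNIV[OF ideal_generalized_eigenspace] assms by blast
  then show ?thesis by (auto simp only: generalized_eigenspace_def)
qed

lemma right_mult_eigenvalue_unique:
  assumes "v \<odot> z = scale c v" "v \<noteq> 0" "y \<odot> z = scale d y" "y \<noteq> 0"
  shows "d = c"
proof -
  have "(shifted_right_mult z c ^^ n) y = scale ((d - c) ^ n) y" for n
    by (induction n) (simp_all add: circ_left assms(3) algebra_simps)
  then show ?thesis
    using right_mult_locally_nilpotent[OF assms(1,2), of y] assms(4) by auto
qed

end

section \<open>Simple Novikov algebras with a transposed product\<close>

locale fd_simple_novikov_algebra =
  simple_novikov_algebra scale circ + closed_field_fd_space scale Basis
  for scale :: "'k::alg_closed_field \<Rightarrow> 'a::ab_group_add \<Rightarrow> 'a"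
    and circ :: "'a \<Rightarrow> 'a \<Rightarrow> 'a" (infixl "\<odot>" 70) and Basis :: "'a set"
begin

lemma exists_common_right_eigenvector:
  "\<exists>v. v \<noteq> 0 \<and> (\<forall>z. \<exists>c. v \<odot> z = scale c v)"
proof -
  obtain x y where "x \<odot> y \<noteq> 0" using simple by (auto simp: simple_def)
  then have "\<exists>v. v \<noteq> 0 \<and> (\<forall>f\<in>range (\<lambda>z x. x \<odot> z). \<exists>c. f v = scale c v)"
    by (intro exists_common_eigenvector) (auto simp: linear_left intro: right_commute)
  then show ?thesis by simp
qed

lemma exists_unit_right_eigenvalue: "\<exists>e v. v \<noteq> 0 \<and> v \<odot> e = v"
proof -
  obtain v where v: "v \<noteq> 0" "\<And>z. \<exists>c. v \<odot> z = scale c v"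
    using exists_common_right_eigenvector by blast
  obtain z where z: "v \<odot> z \<noteq> 0"
    using nonzero_has_nonzero_right_multiple v(1) by blast
  obtain c where c: "v \<odot> z = scale c v" using v(2) by blast
  then have "c \<noteq> 0" using z by auto
  then have "v \<odot> scale (inverse c) z = v"
    by (simp add: circ_right c)
  then show ?thesis using v(1) by blast
qed

lemma dim_le_1_if_commutative:
  assumes comm: "\<And>x y. x \<odot> y = y \<odot> x"
  shows "dim (UNIV :: 'a set) \<le> 1"
proof -
  obtain v where v: "v \<noteq> 0" "\<And>z. \<exists>c. v \<odot> z = scale c v"
    using exists_common_right_eigenvector by blast
  have scalar: "\<exists>c. \<forall>x. x \<odot> z = scale c x" for z
  proof -
    obtain c where c: "v \<odot> z = scale c v" using v(2) by blast
    let ?E = "{x. x \<odot> z = scale c x}"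
    have right: "y \<odot> x \<in> ?E" if "y \<in> ?E" for x y
      using that by (simp add: right_commute[of y x z] circ_left)
    have "x \<odot> y \<in> ?E" if "y \<in> ?E" for x y
      using right[OF that, of x] by (simp only: comm[of x y])
    then have "two_sided_ideal ?E"
      using right
      by (auto simp: two_sided_ideal_def subspace_def circ_left scale_right_distrib mult.commute)
    then have "?E = UNIV" using ideal_eq_UNIV c v(1) by blast
    then show ?thesis by blast
  qed
  obtain e u where e: "u \<noteq> 0" "u \<odot> e = u"
    using exists_unit_right_eigenvalue by blast
  \<comment> \<open>So \<open>e\<close> is a unit, and \<open>x = e \<odot> x\<close> is a multiple of \<open>e\<close> because \<open>R\<^sub>x\<close> is a scalar.\<close>
  have right_unit: "x \<odot> e = x" for x
  proof -
    obtain c where c: "\<And>x. x \<odot> e = scale c x" using scalar by blast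
    then have "scale c u = scale 1 u" using e(2) by simp
    then show ?thesis using e(1) c by (simp del: scale_one add: scale_cancel_right) simp
  qed
  have "x \<in> span {e}" for x
  proof -
    obtain c where "e \<odot> x = scale c e" using scalar by blast
    then have "x = scale c e" using comm[of e x] right_unit[of x] by simp
    then show ?thesis by (auto simp: span_singleton)
  qed
  then show ?thesis
    using dim_le_card[of UNIV "{e}"] by auto
qed

text \<open>
  The kernel of \<open>T\<close> is a right ideal because \<open>T\<close> commutes with right multiplications, and also
  a left ideal because left and right multiples of an element differ by a commutator, which
  \<open>T\<close> kills. Simplicity leaves only the two extreme cases.
\<close>

lemma zero_or_injective_if_commutes_right_kills_commutators:
  assumes lin: "Vector_Spaces.linear scale scale T"
    and comm: "\<And>x z. T (x \<odot> z) = T x \<odot> z"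
    and kill: "\<And>x z. T (x \<odot> z) = T (z \<odot> x)"
  shows "(\<forall>x. T x = 0) \<or> (\<forall>x. T x = 0 \<longrightarrow> x = 0)"
proof -
  interpret T: Vector_Spaces.linear scale scale T by (rule lin)
  have right: "T (x \<odot> z) = 0" if "T x = 0" for x z
    using that by (simp add: comm circ_left)
  have "T (z \<odot> x) = 0" if "T x = 0" for x z
    using right[OF that] kill by metis
  then have "two_sided_ideal {x. T x = 0}"
    using right by (auto simp: two_sided_ideal_def subspace_def T.zero T.add T.scale)
  then show ?thesis using ideal_eq_UNIV by blast
qed

theorem transposed_product_zero:
  assumes tnp: "transposed_novikov_poisson_algebra scale dot (\<odot>)"
    and dim: "dim (UNIV :: 'a set) \<ge> 2"
  shows "dot x y = 0"
proof -
  interpret P: transposed_novikov_poisson_algebra scale dot "(\<odot>)" by (rule tnp)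
  obtain e v where v: "v \<noteq> 0" "v \<odot> e = v"
    using exists_unit_right_eigenvalue by blast
  then have v1: "v \<odot> e = scale 1 v" by simp
  have inj: "y = 0" if "y \<odot> e = 0" for y
    using right_mult_eigenvalue_unique[OF v1 v(1), of y 0] that by auto
  define T where "T = dot e"
  have lin: "Vector_Spaces.linear scale scale T"
    unfolding T_def by (rule P.dot.linear_right)
  interpret T: Vector_Spaces.linear scale scale T by (rule lin)
  have compat: "scale 2 (T (x \<odot> e)) = T x \<odot> e + x \<odot> dot e e" for x
    unfolding T_def by (rule P.transposed_compat)
  define D where "D x = T x \<odot> e - T (x \<odot> e)" for x
  have D_rel: "D x \<odot> e = scale 2 (D (x \<odot> e))" for x
  proof -
    have 1: "scale 2 (T (x \<odot> e) \<odot> e) = (T x \<odot> e) \<odot> e + (x \<odot> dot e e) \<odot> e"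
      using arg_cong[OF compat[of x], of "\<lambda>y. y \<odot> e"] by (simp add: circ_left)
    have 2: "scale 2 (T ((x \<odot> e) \<odot> e)) = T (x \<odot> e) \<odot> e + (x \<odot> dot e e) \<odot> e"
      using compat[of "x \<odot> e"] by (simp add: right_commute)
    show ?thesis
      by (simp add: D_def circ_left scale_right_diff_distrib 1 2)
  qed
  \<comment> \<open>The space is the union of the kernels of the powers of \<open>R\<^sub>e - 1\<close>. If \<open>D\<close> vanishes on one
      of them, then \<open>D (x \<odot> e) = D x\<close> for \<open>x\<close> in the next, so \<open>R\<^sub>e\<close> maps \<open>D x\<close> to \<open>2 D x\<close>; but
      the only eigenvalue of \<open>R\<^sub>e\<close> is \<open>1\<close>.\<close>
  have D_zero: "D x = 0" for x
  proof -
    have "(shifted_right_mult e 1 ^^ n) x = 0 \<Longrightarrow> D x = 0" for n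
    proof (induction n arbitrary: x)
      case 0
      then show ?case by (simp add: D_def circ_left T.zero)
    next
      case (Suc n)
      have "D (x \<odot> e - scale 1 x) = 0"
        by (rule Suc.IH) (use Suc.prems in \<open>simp only: funpow_Suc_right o_apply\<close>)
      moreover have "D (x \<odot> e - scale 1 x) = D (x \<odot> e) - D x"
        by (simp add: D_def circ_left T.diff)
      ultimately have "D (x \<odot> e) = D x" by simp
      then have "D x \<odot> e = scale 2 (D x)" using D_rel[of x] by simp
      moreover have "(2 :: 'k) \<noteq> 1"
        by (metis one_add_one add_cancel_right_left one_neq_zero)
      ultimately show ?case
        using right_mult_eigenvalue_unique[OF v1 v(1), of "D x" 2] by blast
    qed
    then show ?thesis using right_mult_locally_nilpotent[OF v1 v(1)] by blast
  qed
  then have T_comm_e: "T (x \<odot> e) = T x \<odot> e" for x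
    by (simp add: D_def)
  have T_e: "T x \<odot> e = x \<odot> dot e e" for x
  proof -
    have "scale (1 + 1) (T x \<odot> e) = T x \<odot> e + x \<odot> dot e e"
      using compat[of x] by (simp add: T_comm_e)
    then show ?thesis by (simp only: scale_left_distrib scale_one add_left_cancel)
  qed
  have T_comm: "T (x \<odot> z) = T x \<odot> z" for x z
  proof -
    have "(T (x \<odot> z) - T x \<odot> z) \<odot> e = 0"
      by (simp add: circ_left T_e right_commute[of _ z])
    then show ?thesis using inj by fastforce
  qed
  have T_dot: "dot x z \<odot> e = T (x \<odot> z)" for x z
    unfolding T_comm unfolding T_def
    by (metis P.dot_circ_commute P.dot.dot_commute)
  have kill: "T (x \<odot> z) = T (z \<odot> x)" for x z
    by (metis T_dot P.dot.dot_commute)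
  consider "\<forall>x. T x = 0" | "\<forall>x. T x = 0 \<longrightarrow> x = 0"
    using zero_or_injective_if_commutes_right_kills_commutators[OF lin T_comm kill] by blast
  then show ?thesis
  proof cases
    case 1
    then show ?thesis using T_dot inj by simp
  next
    case 2
    have "x \<odot> z = z \<odot> x" for x z
      using 2[rule_format, of "x \<odot> z - z \<odot> x"] kill[of x z] by (simp add: T.diff)
    then show ?thesis using dim_le_1_if_commutative dim by fastforce
  qed
qed

end

theorem corollary4p12:
  fixes scale :: "'k::alg_closed_field \<Rightarrow> 'a::ab_group_add \<Rightarrow> 'a"
    and circ :: "'a \<Rightarrow> 'a \<Rightarrow> 'a"
    and p :: nat
  assumes "CHAR('k) = p" and "p > 2"
    and "simple_novikov_algebra scale circ"
    and "\<exists>B. finite_dimensional_vector_space scale B"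
    and "vector_space.dim scale (UNIV :: 'a set) \<ge> 2"
  shows "\<not> (\<exists>dot. nontrivial_tnp_structure scale circ dot)"
proof
  assume "\<exists>dot. nontrivial_tnp_structure scale circ dot"
  then obtain dot where tnp: "transposed_novikov_poisson_algebra scale dot circ"
    and nontriv: "\<not> transposed_novikov_poisson_algebra.trivial dot circ"
    by (auto simp: nontrivial_tnp_structure_def)
  obtain B where B: "finite_dimensional_vector_space scale B"
    using assms(4) by blast
  interpret fd_simple_novikov_algebra scale circ B
    by (intro fd_simple_novikov_algebra.intro closed_field_fd_space.intro assms(3) B)
  have "dot x y = 0" for x y
    using transposed_product_zero[OF tnp] assms(5) by blast
  then show False
    using nontriv transposed_novikov_poisson_algebra.trivial_def[OF tnp] by blast
qed

end
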